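(* Let $M$ be a binomial random variable of $n\in\mathbb{N}$ trials, each with success probability $p\in(0,1]$. Then $$\mathbb{E}\left[\left(J(n)-J(M)\right)^2\right]=\sum_{m=2}^n\sum_{k=1}^{m-1}\frac{(1-p)^m}{k(m-k)}+\sum_{m=1}^n\sum_{k=n-m+1}^n\frac{(1-p)^m}{mk}$$ $$=(\log p)^2-\sum_{m=n+1}^\infty\sum_{k=1}^{m-1}\frac{(1-p)^m}{k(m-k)}+\sum_{m=1}^n\sum_{k=n-m+1}^n\frac{(1-p)^m}{mk}.$$
   Context: $\mathbb{N}=\{1,2,3,\dots\}$, $\log$ is the natural logarithm, and $J(m)=\sum_{k=1}^m 1/k$ is the $m$-th harmonic number with $J(0)=0$. Empty sums are $0$. *)

theory Defs
  imports "HOL-Probability.Probability"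
begin

end

theory Submission
  imports Defs
begin

text \<open>
  Write $q = 1 - p$ and let $E_n$ be the expectation under the binomial distribution with
  $n$ trials. Conditioning on the last trial and size-biasing give
  $n (E_n f - E_{n-1} f) = E_n [k (f(k) - f(k-1))]$. For $f = J$ the right-hand side is
  $1 - q^n$; for $f = J^2$ it is $2 E_n J - r_n$, where $r_n = E_n[1/k; k \ge 1]$ satisfies
  $r_n = q r_{n-1} + (1 - q^n)/n$. This determines the increments in $n$ of
  $E_n[(J(n) - J)^2]$, and they agree with those of the claimed double sums. The second formula
  follows because the full double series is the Cauchy square of $-\log(1-q) = \sum_k q^k/k$.
\<close>

section \<open>Expectations under the binomial distribution as finite sums\<close>

definition binomial_mean :: "real \<Rightarrow> nat \<Rightarrow> (nat \<Rightarrow> real) \<Rightarrow> real" where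
  "binomial_mean p n f = (\<Sum>k\<le>n. real (n choose k) * p ^ k * (1 - p) ^ (n - k) * f k)"

lemma binomial_mean_add:
  "binomial_mean p n (\<lambda>k. f k + g k) = binomial_mean p n f + binomial_mean p n g"
  by (simp add: binomial_mean_def sum.distrib distrib_left)

lemma binomial_mean_diff:
  "binomial_mean p n (\<lambda>k. f k - g k) = binomial_mean p n f - binomial_mean p n g"
  by (simp add: binomial_mean_def sum_subtractf right_diff_distrib)

lemma binomial_mean_cmult:
  "binomial_mean p n (\<lambda>k. c * f k) = c * binomial_mean p n f"
  by (simp add: binomial_mean_def sum_distrib_left mult_ac)

lemma binomial_mean_const: "binomial_mean p n (\<lambda>_. c) = c"
proof -
  have "(\<Sum>k\<le>n. real (n choose k) * p ^ k * (1 - p) ^ (n - k)) = 1"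
    using binomial_ring[of p "1 - p" n] by simp
  then show ?thesis
    by (simp add: binomial_mean_def flip: sum_distrib_right)
qed

lemma binomial_mean_indicator_pos:
  "binomial_mean p n (\<lambda>k. if k = 0 then 0 else 1) = 1 - (1 - p) ^ n"
proof -
  have "binomial_mean p n (\<lambda>k. if k = 0 then 1 else 0) = (1 - p) ^ n"
    by (simp add: binomial_mean_def if_distrib cong: if_cong)
  moreover have "(\<lambda>k::nat. if k = 0 then 0 else 1 :: real) = (\<lambda>k. 1 - (if k = 0 then 1 else 0))"
    by auto
  ultimately show ?thesis
    by (simp add: binomial_mean_diff binomial_mean_const)
qed

text \<open>Conditioning on the last trial. In terms of coefficients this is Pascal's rule applied
  to \<open>Suc n choose Suc k\<close>, with the \<open>k = 0\<close> term split off.\<close>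

lemma binomial_mean_Suc:
  "binomial_mean p (Suc n) f =
    (1 - p) * binomial_mean p n f + p * binomial_mean p n (\<lambda>k. f (Suc k))"
proof -
  have "binomial_mean p (Suc n) f = (1 - p) ^ Suc n * f 0 +
      (\<Sum>k\<le>n. real (Suc n choose Suc k) * p ^ Suc k * (1 - p) ^ (n - k) * f (Suc k))"
    unfolding binomial_mean_def by (subst sum.atMost_Suc_shift) simp
  also have "(\<Sum>k\<le>n. real (Suc n choose Suc k) * p ^ Suc k * (1 - p) ^ (n - k) * f (Suc k)) =
      p * binomial_mean p n (\<lambda>k. f (Suc k)) +
      (\<Sum>k\<le>n. real (n choose Suc k) * p ^ Suc k * (1 - p) ^ (n - k) * f (Suc k))"
    by (simp add: binomial_mean_def sum_distrib_left algebra_simps flip: sum.distrib)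
  \<comment> \<open>The term \<open>k = n\<close> vanishes because
    \<open>n choose Suc n = 0\<close>. It must go before one factor \<open>1 - p\<close> is
    extracted, since \<open>n - k = Suc (n - Suc k)\<close> requires \<open>k < n\<close>.\<close>
  also have "(\<Sum>k\<le>n. real (n choose Suc k) * p ^ Suc k * (1 - p) ^ (n - k) * f (Suc k)) =
      (\<Sum>k<n. real (n choose Suc k) * p ^ Suc k * (1 - p) ^ (n - k) * f (Suc k))"
    by (rule sum.mono_neutral_right) (auto simp: not_less)
  also have "\<dots> = (1 - p) *
      (\<Sum>k<n. real (n choose Suc k) * p ^ Suc k * (1 - p) ^ (n - Suc k) * f (Suc k))"
    unfolding sum_distrib_left
  proof (rule sum.cong)
    fix k assume "k \<in> {..<n}"
    then have "n - k = Suc (n - Suc k)" by auto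
    then show "real (n choose Suc k) * p ^ Suc k * (1 - p) ^ (n - k) * f (Suc k) =
        (1 - p) * (real (n choose Suc k) * p ^ Suc k * (1 - p) ^ (n - Suc k) * f (Suc k))"
      by simp
  qed simp
  also have "(1 - p) ^ Suc n * f 0 + (p * binomial_mean p n (\<lambda>k. f (Suc k)) + \<dots>) =
      (1 - p) * ((1 - p) ^ n * f 0 +
        (\<Sum>k<n. real (n choose Suc k) * p ^ Suc k * (1 - p) ^ (n - Suc k) * f (Suc k))) +
      p * binomial_mean p n (\<lambda>k. f (Suc k))"
    by (simp add: algebra_simps)
  also have "(1 - p) ^ n * f 0 +
        (\<Sum>k<n. real (n choose Suc k) * p ^ Suc k * (1 - p) ^ (n - Suc k) * f (Suc k)) =
      binomial_mean p n f"
    unfolding binomial_mean_def by (subst sum.atMost_shift) simp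
  finally show ?thesis .
qed

text \<open>The absorption identity for binomial coefficients, termwise; on the right the factor
  \<open>real k\<close> removes the term \<open>k = 0\<close>.\<close>

lemma binomial_mean_size_bias:
  "real (Suc n) * p * binomial_mean p n (\<lambda>k. g (Suc k)) =
    binomial_mean p (Suc n) (\<lambda>k. real k * g k)"
proof -
  have "binomial_mean p (Suc n) (\<lambda>k. real k * g k) =
      (\<Sum>k\<le>n. real (Suc n choose Suc k) * p ^ Suc k * (1 - p) ^ (n - k) * (real (Suc k) * g (Suc k)))"
    unfolding binomial_mean_def by (subst sum.atMost_Suc_shift) simp
  also have "\<dots> = (\<Sum>k\<le>n. real (Suc n) * p *
      (real (n choose k) * p ^ k * (1 - p) ^ (n - k) * g (Suc k)))"
  proof (rule sum.cong)
    fix k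
    have "real (Suc k) * real (Suc n choose Suc k) = real (Suc n) * real (n choose k)"
      by (metis Suc_times_binomial_eq mult.commute of_nat_mult)
    then show "real (Suc n choose Suc k) * p ^ Suc k * (1 - p) ^ (n - k) * (real (Suc k) * g (Suc k)) =
        real (Suc n) * p * (real (n choose k) * p ^ k * (1 - p) ^ (n - k) * g (Suc k))"
      by (simp del: of_nat_Suc binomial_Suc_Suc add: mult_ac)
  qed simp
  finally show ?thesis
    by (simp add: binomial_mean_def sum_distrib_left)
qed

text \<open>Conditioning leaves \<open>p\<close> times the mean of a forward difference, and
  size-biasing turns it into a backward one. The truncated \<open>k - 1\<close> at
  \<open>k = 0\<close> is harmless because of the factor \<open>real k\<close>.\<close>

lemma binomial_mean_increment:
  "real (Suc n) * (binomial_mean p (Suc n) f - binomial_mean p n f) =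
    binomial_mean p (Suc n) (\<lambda>k. real k * (f k - f (k - 1)))"
proof -
  have "binomial_mean p (Suc n) f - binomial_mean p n f =
      p * binomial_mean p n (\<lambda>k. f (Suc k) - f (Suc k - 1))"
    by (simp add: binomial_mean_Suc binomial_mean_diff algebra_simps)
  then show ?thesis
    using binomial_mean_size_bias[of n p "\<lambda>k. f k - f (k - 1)"] by (simp add: mult.assoc)
qed

section \<open>Binomial means of harmonic numbers, reciprocals and squares\<close>

lemma harm_pred: "0 < k \<Longrightarrow> (harm k :: real) = harm (k - 1) + 1 / real k"
  by (cases k) (simp_all add: harm_Suc field_simps)

text \<open>Since \<open>harm\<close> grows by \<open>1 / k\<close> at \<open>k\<close>, the
  weighted difference in the increment formula is the indicator of \<open>k > 0\<close>, whose mean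
  is known.\<close>

lemma binomial_mean_harm:
  "binomial_mean p n harm = harm n - (\<Sum>m=1..n. (1 - p) ^ m / real m)"
proof (induction n)
  case 0
  show ?case by (simp add: binomial_mean_def harm_def)
next
  case (Suc n)
  have "(\<lambda>k. real k * (harm k - harm (k - 1))) = (\<lambda>k. if k = 0 then 0 else 1)"
    by (auto simp: harm_pred)
  then have "real (Suc n) * (binomial_mean p (Suc n) harm - binomial_mean p n harm) =
      1 - (1 - p) ^ Suc n"
    by (simp only: binomial_mean_increment binomial_mean_indicator_pos)
  then have "binomial_mean p (Suc n) harm =
      binomial_mean p n harm + (1 - (1 - p) ^ Suc n) / real (Suc n)"
    by (simp add: field_simps del: of_nat_Suc power_Suc)
  with Suc show ?case
    by (simp add: harm_Suc diff_divide_distrib inverse_eq_divide del: of_nat_Suc power_Suc)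
qed

text \<open>The junk value \<open>1 / 0 = 0\<close> realises the restriction of the expectation to \<open>k \<ge> 1\<close>.\<close>

lemma binomial_mean_inverse:
  "binomial_mean p n (\<lambda>k. 1 / real k) =
    (\<Sum>m<n. (1 - p) ^ m / (real n - real m)) - (1 - p) ^ n * harm n"
proof (induction n)
  case 0
  show ?case by (simp add: binomial_mean_def harm_def)
next
  case (Suc n)
  have "(\<lambda>k. real k * (1 / real k)) = (\<lambda>k. if k = 0 then 0 else 1)"
    by auto
  then have "real (Suc n) * p * binomial_mean p n (\<lambda>k. 1 / real (Suc k)) = 1 - (1 - p) ^ Suc n"
    by (simp only: binomial_mean_size_bias[of n p "\<lambda>k. 1 / real k"] binomial_mean_indicator_pos)
  then have "p * binomial_mean p n (\<lambda>k. 1 / real (Suc k)) = (1 - (1 - p) ^ Suc n) / real (Suc n)"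
    by (simp add: field_simps del: of_nat_Suc power_Suc)
  then have *: "binomial_mean p (Suc n) (\<lambda>k. 1 / real k) =
      (1 - p) * binomial_mean p n (\<lambda>k. 1 / real k) + (1 - (1 - p) ^ Suc n) / real (Suc n)"
    by (simp only: binomial_mean_Suc)
  \<comment> \<open>Splitting off \<open>m = 0\<close> and shifting the index shows that the closed
    form obeys the same recurrence.\<close>
  have **: "(\<Sum>m<Suc n. (1 - p) ^ m / (real (Suc n) - real m)) =
      1 / real (Suc n) + (1 - p) * (\<Sum>m<n. (1 - p) ^ m / (real n - real m))"
    by (subst sum.lessThan_Suc_shift) (simp add: sum_distrib_left)
  show ?case
    unfolding * ** Suc
    by (simp add: harm_Suc add_divide_distrib diff_divide_distrib inverse_eq_divide algebra_simps del: of_nat_Suc)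
qed

text \<open>Factor the difference of squares: \<open>harm k - harm (k - 1)\<close> is
  \<open>1 / k\<close>, and \<open>harm k + harm (k - 1)\<close> is
  \<open>2 * harm k - 1 / k\<close>. At \<open>k = 0\<close> both sides are 0.\<close>

lemma binomial_mean_harm_square_increment:
  "real (Suc n) * (binomial_mean p (Suc n) (\<lambda>k. (harm k)\<^sup>2) - binomial_mean p n (\<lambda>k. (harm k)\<^sup>2)) =
    2 * binomial_mean p (Suc n) harm - binomial_mean p (Suc n) (\<lambda>k. 1 / real k)"
proof -
  have "(\<lambda>k. real k * ((harm k)\<^sup>2 - (harm (k - 1))\<^sup>2)) = (\<lambda>k. 2 * harm k - 1 / real k)"
  proof
    fix k :: nat
    show "real k * ((harm k)\<^sup>2 - (harm (k - 1))\<^sup>2) = 2 * harm k - 1 / real k"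
    proof (cases "k = 0")
      case True
      then show ?thesis by (simp add: harm_def)
    next
      case False
      then show ?thesis by (simp add: harm_pred power2_eq_square field_simps)
    qed
  qed
  then show ?thesis
    by (simp only: binomial_mean_increment binomial_mean_diff binomial_mean_cmult)
qed

section \<open>The double sums and their increments\<close>

lemma sum_inverse_convolution:
  assumes "m \<noteq> 0"
  shows "(\<Sum>k=1..m-1. x / (real k * (real m - real k))) = 2 * harm (m - 1) * x / real m"
proof -
  \<comment> \<open>Partial fractions; the reflection of \<open>k\<close> to \<open>m - k\<close>
    then makes the two halves equal.\<close>
  have "(\<Sum>k=1..m-1. x / (real k * (real m - real k))) =
      (\<Sum>k=1..m-1. x / real m * (1 / real k + 1 / (real m - real k)))"
  proof (rule sum.cong)
    fix k assume k: "k \<in> {1..m-1}"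
    then have "real k \<noteq> 0" "real m - real k \<noteq> 0" using assms by auto
    then show "x / (real k * (real m - real k)) = x / real m * (1 / real k + 1 / (real m - real k))"
      using assms by (simp add: divide_simps)
  qed simp
  also have "\<dots> = x / real m * ((\<Sum>k=1..m-1. 1 / real k) + (\<Sum>k=1..m-1. 1 / (real m - real k)))"
    by (simp add: sum_distrib_left distrib_left sum.distrib)
  also have "(\<Sum>k=1..m-1. 1 / (real m - real k)) = (\<Sum>k=1..m-1. 1 / real k)"
    by (rule sum.reindex_bij_witness[of _ "\<lambda>k. m - k" "\<lambda>k. m - k"]) (auto simp: of_nat_diff)
  finally show ?thesis
    by (simp add: harm_def inverse_eq_divide)
qed

lemma sum_harm_tail:
  assumes "m \<le> n"
  shows "(\<Sum>k=n-m+1..n. x / (real m * real k)) = x / real m * (harm n - harm (n - m))"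
proof -
  have "(harm n :: real) = harm (n - m) + (\<Sum>k=n-m+1..n. 1 / real k)"
    using sum.ub_add_nat[of 1 "n - m" "\<lambda>k. 1 / real k" m] assms
    by (simp add: harm_def inverse_eq_divide)
  then show ?thesis
    by (simp add: sum_distrib_left)
qed

text \<open>For \<open>m \<le> n\<close> the harmonic difference changes by
  \<open>1 / (n+1) - 1 / (n+1-m)\<close>, which is \<open>- m / ((n+1) (n+1-m))\<close>, so the
  denominator \<open>m\<close> cancels. The new index \<open>m = n + 1\<close> gives the
  \<open>harm (Suc n)\<close> term, and \<open>1 / (n+1)\<close> offsets the \<open>m = 0\<close>
  term of the last sum, which is kept to match \<open>binomial_mean_inverse\<close>.\<close>

lemma harm_tail_sum_increment:
  fixes q :: real
  shows "(\<Sum>m=1..Suc n. q ^ m / real m * (harm (Suc n) - harm (Suc n - m))) =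
    (\<Sum>m=1..n. q ^ m / real m * (harm n - harm (n - m))) +
    (1 / real (Suc n) + q ^ Suc n * harm (Suc n) - (\<Sum>m<Suc n. q ^ m / (real (Suc n) - real m)))
      / real (Suc n)"
proof -
  have "(\<Sum>m=1..n. q ^ m / real m * (harm (Suc n) - harm (Suc n - m))) =
      (\<Sum>m=1..n. q ^ m / real m * (harm n - harm (n - m)) -
        q ^ m / (real (Suc n) - real m) / real (Suc n))"
  proof (rule sum.cong)
    fix m assume m: "m \<in> {1..n}"
    then have harm_tail: "(harm (Suc n - m) :: real) = harm (n - m) + 1 / (real (Suc n) - real m)"
      by (simp add: Suc_diff_le harm_Suc inverse_eq_divide of_nat_diff algebra_simps)
    have "real (Suc n) - real m \<noteq> 0" using m by auto
    then have "q ^ m / real m * (1 / real (Suc n) - 1 / (real (Suc n) - real m)) =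
        - (q ^ m / (real (Suc n) - real m) / real (Suc n))"
      using m by (simp add: divide_simps del: of_nat_Suc)
    then show "q ^ m / real m * (harm (Suc n) - harm (Suc n - m)) =
        q ^ m / real m * (harm n - harm (n - m)) - q ^ m / (real (Suc n) - real m) / real (Suc n)"
      unfolding harm_tail by (simp add: harm_Suc inverse_eq_divide algebra_simps del: of_nat_Suc)
  qed simp
  moreover have "(\<Sum>m<Suc n. q ^ m / (real (Suc n) - real m)) =
      1 / real (Suc n) + (\<Sum>m=1..n. q ^ m / (real (Suc n) - real m))"
    by (simp add: lessThan_Suc_atMost atMost_atLeast0 sum.atLeast_Suc_atMost)
  ultimately show ?thesis
    by (simp add: sum_subtractf sum_divide_distrib add_divide_distrib diff_divide_distrib harm_def
        del: of_nat_Suc power_Suc)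
qed

lemma binomial_mean_harm_diff_square:
  "binomial_mean p n (\<lambda>k. (harm n - harm k)\<^sup>2) =
    (\<Sum>m=2..n. \<Sum>k=1..m-1. (1 - p) ^ m / (real k * (real m - real k))) +
    (\<Sum>m=1..n. \<Sum>k=n-m+1..n. (1 - p) ^ m / (real m * real k))"
proof -
  define q where "q = 1 - p"
  define a where "a n = (\<Sum>m=1..n. q ^ m / real m)" for n
  define s where "s n = binomial_mean p n (\<lambda>k. (harm k)\<^sup>2)" for n
  define u where "u n = (\<Sum>m=1..n. 2 * harm (m - 1) * q ^ m / real m)" for n
  define t where "t n = (\<Sum>m=1..n. q ^ m / real m * (harm n - harm (n - m)))" for n
  have mean: "binomial_mean p n harm = harm n - a n" for n
    by (simp add: binomial_mean_harm a_def q_def)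
  \<comment> \<open>This is the goal solved for the second moment \<open>s n\<close>, after
    expanding the square; \<open>u\<close> and \<open>t\<close> are the two double sums with their
    inner sums evaluated.\<close>
  have "s n = (harm n)\<^sup>2 - 2 * harm n * a n + u n + t n"
  proof (induction n)
    case 0
    show ?case by (simp add: s_def u_def t_def a_def harm_def binomial_mean_def)
  next
    case (Suc n)
    define N where "N = real (Suc n)"
    define w where "w = (\<Sum>m<Suc n. q ^ m / (real (Suc n) - real m))"
    have "N \<noteq> 0" by (simp add: N_def)
    have "N * (s (Suc n) - s n) = 2 * (harm (Suc n) - a (Suc n)) - (w - q ^ Suc n * harm (Suc n))"
      by (simp only: N_def s_def binomial_mean_harm_square_increment mean binomial_mean_inverse
          w_def q_def)
    then have s_Suc: "s (Suc n) = s n +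
        (2 * (harm (Suc n) - a (Suc n)) - (w - q ^ Suc n * harm (Suc n))) / N"
      using \<open>N \<noteq> 0\<close> by (simp add: field_simps del: power_Suc)
    have a_Suc: "a (Suc n) = a n + q ^ Suc n / N"
      by (simp add: a_def N_def)
    have u_Suc: "u (Suc n) = u n + 2 * harm n * q ^ Suc n / N"
      by (simp add: u_def N_def)
    have t_Suc: "t (Suc n) = t n + (1 / N + q ^ Suc n * harm (Suc n) - w) / N"
      unfolding t_def N_def w_def by (rule harm_tail_sum_increment)
    have harm_eq: "harm (Suc n) = harm n + 1 / N"
      by (simp add: harm_Suc N_def inverse_eq_divide)
    show ?case
      unfolding s_Suc a_Suc u_Suc t_Suc harm_eq Suc using \<open>N \<noteq> 0\<close>
      by (simp add: field_simps power2_eq_square del: power_Suc)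
  qed
  moreover have "binomial_mean p n (\<lambda>k. (harm n - harm k)\<^sup>2) =
      (harm n)\<^sup>2 + s n - 2 * harm n * (harm n - a n)"
    by (simp only: power2_diff binomial_mean_diff binomial_mean_add binomial_mean_const
        binomial_mean_cmult mean s_def)
  moreover have "(\<Sum>m=2..n. \<Sum>k=1..m-1. (1 - p) ^ m / (real k * (real m - real k))) = u n"
  proof -
    \<comment> \<open>The term \<open>m = 1\<close> is zero because \<open>harm 0 = 0\<close>;
      starting \<open>u\<close> at 1 makes its recurrence uniform in \<open>n\<close>.\<close>
    have "u n = (\<Sum>m=2..n. 2 * harm (m - 1) * q ^ m / real m)"
      unfolding u_def
      by (rule sum.mono_neutral_right) (auto simp: harm_def not_le less_Suc_eq numeral_2_eq_2)
    also have "\<dots> = (\<Sum>m=2..n. \<Sum>k=1..m-1. (1 - p) ^ m / (real k * (real m - real k)))"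
      by (rule sum.cong) (simp_all only: refl q_def, subst sum_inverse_convolution, auto)
    finally show ?thesis by simp
  qed
  moreover have "(\<Sum>m=1..n. \<Sum>k=n-m+1..n. (1 - p) ^ m / (real m * real k)) = t n"
    unfolding t_def q_def by (rule sum.cong[OF refl], rule sum_harm_tail) auto
  ultimately show ?thesis
    by (simp add: power2_eq_square algebra_simps)
qed

section \<open>The full double series\<close>

lemma ln_square_has_sum:
  fixes q :: real
  assumes "0 \<le> q" "q < 1"
  shows "((\<lambda>m. \<Sum>k=1..m-1. q ^ m / (real k * (real m - real k))) has_sum (ln (1 - q))\<^sup>2) UNIV"
proof -
  define c where "c k = q ^ k / real k" for k
  have c_nonneg: "c k \<ge> 0" for k using assms by (simp add: c_def)
  have c_sums: "c sums (- ln (1 - q))"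
    using sums_minus[OF ln_series'[of "- q"]] assms by (simp add: c_def[abs_def])
  then have "summable (\<lambda>k. norm (c k))"
    using c_nonneg by (simp add: sums_iff)
  from Cauchy_product_sums[OF this this]
  have "(\<lambda>m. \<Sum>k\<le>m. c k * c (m - k)) sums (ln (1 - q))\<^sup>2"
    using c_sums by (simp add: sums_iff power2_eq_square)
  moreover have "(\<Sum>k\<le>m. c k * c (m - k)) = (\<Sum>k=1..m-1. q ^ m / (real k * (real m - real k)))" for m
  proof -
    \<comment> \<open>Division by zero gives \<open>c 0 = 0\<close>, so the end terms
      \<open>k = 0\<close> and \<open>k = m\<close> of the Cauchy product drop out.\<close>
    have "(\<Sum>k\<le>m. c k * c (m - k)) = (\<Sum>k=1..m-1. c k * c (m - k))"
      by (rule sum.mono_neutral_right) (auto simp: c_def not_le less_Suc_eq)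
    also have "\<dots> = (\<Sum>k=1..m-1. q ^ m / (real k * (real m - real k)))"
      by (rule sum.cong) (auto simp: c_def of_nat_diff simp flip: power_add)
    finally show ?thesis .
  qed
  ultimately have "(\<lambda>m. \<Sum>k=1..m-1. q ^ m / (real k * (real m - real k))) sums (ln (1 - q))\<^sup>2"
    by simp
  \<comment> \<open>Nonnegative terms upgrade ordered to unconditional summation, so that the series
    can be split over index sets.\<close>
  then show ?thesis
    using assms by (intro sums_nonneg_imp_has_sum sum_nonneg) auto
qed

theorem propositionB1:
  fixes \<Omega> :: "'a measure" and M :: "'a \<Rightarrow> nat" and n :: nat and p :: real
  assumes "prob_space \<Omega>"
    and "M \<in> measurable \<Omega> (count_space UNIV)"
    and "distr \<Omega> (count_space UNIV) M = measure_pmf (binomial_pmf n p)"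
    and "n \<ge> 1" and "0 < p" and "p \<le> 1"
  shows
   "(integrable \<Omega> (\<lambda>\<omega>. (harm n - harm (M \<omega>) :: real)\<^sup>2)) \<and>
    ((\<integral>\<omega>. (harm n - harm (M \<omega>) :: real)\<^sup>2 \<partial>\<Omega>) =
          (\<Sum>m=2..n. \<Sum>k=1..m-1. (1 - p) ^ m / (real k * (real m - real k)))
          + (\<Sum>m=1..n. \<Sum>k=n-m+1..n. (1 - p) ^ m / (real m * real k))) \<and>
    ((\<lambda>m. \<Sum>k=1..m-1. (1 - p) ^ m / (real k * (real m - real k))) summable_on {n+1..}) \<and>
    ((\<integral>\<omega>. (harm n - harm (M \<omega>) :: real)\<^sup>2 \<partial>\<Omega>) =
          (ln p)\<^sup>2
          - (\<Sum>\<^sub>\<infinity>m\<in>{n+1..}. \<Sum>k=1..m-1. (1 - p) ^ m / (real k * (real m - real k)))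
          + (\<Sum>m=1..n. \<Sum>k=n-m+1..n. (1 - p) ^ m / (real m * real k)))"
proof -
  define f where "f k = (harm n - harm k :: real)\<^sup>2" for k
  define g where "g m = (\<Sum>k=1..m-1. (1 - p) ^ m / (real k * (real m - real k)))" for m
  \<comment> \<open>The finite support makes every function integrable and reduces the expectation
    to the finite sum \<open>binomial_mean\<close>.\<close>
  have set_pmf: "set_pmf (binomial_pmf n p) \<subseteq> {..n}"
    using assms by (auto simp: set_pmf_binomial_eq)
  have "integrable (measure_pmf (binomial_pmf n p)) f"
    by (rule integrable_measure_pmf_finite) (rule finite_subset[OF set_pmf], simp)
  then have integrable: "integrable \<Omega> (\<lambda>\<omega>. f (M \<omega>))"
    using integrable_distr_eq[OF assms(2), of f] assms(3) by simp
  have "(\<integral>\<omega>. f (M \<omega>) \<partial>\<Omega>) = measure_pmf.expectation (binomial_pmf n p) f"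
    using integral_distr[OF assms(2), of f] assms(3) by simp
  also have "\<dots> = binomial_mean p n f"
    using set_pmf assms
    by (subst integral_measure_pmf[of "{..n}"]) (auto simp: binomial_mean_def mult_ac)
  also have "\<dots> = sum g {2..n} + (\<Sum>m=1..n. \<Sum>k=n-m+1..n. (1 - p) ^ m / (real m * real k))"
    unfolding f_def g_def by (rule binomial_mean_harm_diff_square)
  finally have mean: "(\<integral>\<omega>. f (M \<omega>) \<partial>\<Omega>) =
      sum g {2..n} + (\<Sum>m=1..n. \<Sum>k=n-m+1..n. (1 - p) ^ m / (real m * real k))" .
  have has_sum: "(g has_sum (ln p)\<^sup>2) UNIV"
    using ln_square_has_sum[of "1 - p"] assms by (simp add: g_def[abs_def])
  then have summable: "g summable_on A" for A
    by (meson summable_on_def summable_on_subset_banach subset_UNIV)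
  \<comment> \<open>Cut the full series at \<open>n\<close>: the first double sum is the total
    \<open>(ln p)\<close> squared minus the tail.\<close>
  have "{..n} \<union> {n+1..} = UNIV" by auto
  then have "(ln p)\<^sup>2 = infsum g ({..n} \<union> {n+1..})"
    using infsumI[OF has_sum] by simp
  also have "\<dots> = infsum g {..n} + infsum g {n+1..}"
    by (rule infsum_Un_disjoint) (auto intro: summable)
  \<comment> \<open>\<open>g 0\<close> and \<open>g 1\<close> are empty sums.\<close>
  also have "infsum g {..n} = sum g {2..n}"
    unfolding infsum_finite[OF finite_atMost]
    by (rule sum.mono_neutral_right) (auto simp: g_def not_le less_Suc_eq numeral_2_eq_2)
  finally have "sum g {2..n} = (ln p)\<^sup>2 - infsum g {n+1..}" by simp
  with mean integrable summable show ?thesis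
    unfolding f_def g_def by simp
qed

end
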